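(* Let $(\mathcal{L},\|\cdot\|)$ be a normed (complex) vector space and let $(b_N)_{N\ge1}$ be a sequence of linear forms on $\mathcal{L}$. Assume that: (i) there exists $C>0$ such that for any $\varphi\in\mathcal{L}$ and large enough $N\ge1$, one has $|b_N(\varphi)|\le C\|\varphi\|$; (ii) there exist a dense linear subspace $\mathcal{L}_1\subset\mathcal{L}$ and a linear form $b:\mathcal{L}_1\to\mathbb{C}$ such that $b_N(\varphi)\to b(\varphi)$ as $N\to+\infty$ for all $\varphi\in\mathcal{L}_1$. Then $b$ admits a unique continuous (linear) extension to $\mathcal{L}$, still denoted by $b$, and $b_N(\varphi)\to b(\varphi)$ as $N\to+\infty$ for all $\varphi\in\mathcal{L}$.
   Context: In (i), "for any $\varphi$ and large enough $N$" means that for each $\varphi\in\mathcal{L}$ there is $N_0$ (possibly depending on $\varphi$) such that the bound holds for all $N\ge N_0$, with the constant $C$ independent of $\varphi$ and $N$. *)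

theory Defs
  imports "HOL-Analysis.Analysis"
begin

text \<open>
  Complex normed spaces. Norm, metric and topology are those of the underlying real normed
  space; the assumption \<open>scaleR_scaleC\<close> says that its real scalar multiplication is
  the restriction of the complex one.
\<close>

class complex_normed_vector = real_normed_vector +
  fixes scaleC :: "complex \<Rightarrow> 'a \<Rightarrow> 'a"  (infixr "*\<^sub>C" 75)
  assumes scaleR_scaleC: "scaleR r x = complex_of_real r *\<^sub>C x"
    and scaleC_add_right: "a *\<^sub>C (x + y) = a *\<^sub>C x + a *\<^sub>C y"
    and scaleC_add_left: "(a + b) *\<^sub>C x = a *\<^sub>C x + b *\<^sub>C x"
    and scaleC_scaleC: "a *\<^sub>C b *\<^sub>C x = (a * b) *\<^sub>C x"
    and scaleC_one: "1 *\<^sub>C x = x"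
    and norm_scaleC: "norm (a *\<^sub>C x) = cmod a * norm x"

global_interpretation complex_vector:
  vector_space "scaleC :: complex \<Rightarrow> 'a \<Rightarrow> 'a::complex_normed_vector"
  by unfold_locales
    (simp_all add: scaleC_add_right scaleC_add_left scaleC_scaleC scaleC_one)

instantiation complex :: complex_normed_vector
begin

definition scaleC_complex :: "complex \<Rightarrow> complex \<Rightarrow> complex"
  where "scaleC_complex = (*)"

instance
  by standard
    (simp_all add: scaleC_complex_def scaleR_conv_of_real algebra_simps norm_mult)

end

text \<open>Linear forms need not be continuous.\<close>

abbreviation linear_form :: "('a::complex_normed_vector \<Rightarrow> complex) \<Rightarrow> bool"
  where "linear_form f \<equiv> Vector_Spaces.linear scaleC (*) f"

text \<open>
  A linear form on a subspace \<open>S\<close> is a total function of which only the values on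
  \<open>S\<close> matter.
\<close>

definition linear_form_on :: "'a::complex_normed_vector set \<Rightarrow> ('a \<Rightarrow> complex) \<Rightarrow> bool"
  where "linear_form_on S f \<longleftrightarrow>
    (\<forall>x\<in>S. \<forall>y\<in>S. f (x + y) = f x + f y) \<and>
    (\<forall>c. \<forall>x\<in>S. f (c *\<^sub>C x) = c * f x)"

text \<open>The values of \<open>f\<close> outside \<open>S\<close> are irrelevant here as well.\<close>

definition continuous_extension ::
  "'a::complex_normed_vector set \<Rightarrow> ('a \<Rightarrow> complex) \<Rightarrow> ('a \<Rightarrow> complex) \<Rightarrow> bool"
  where "continuous_extension S f g \<longleftrightarrow>
    continuous_on UNIV g \<and> (\<forall>x\<in>S. g x = f x)"

end

theory Submission
  imports Defs
begin

text \<open>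
  The point is that an eventual bound \<open>cmod (bN N \<phi>) \<le> C * norm \<phi>\<close> suffices even though the
  threshold on \<open>N\<close> varies with \<open>\<phi>\<close>. Indeed, to
  test whether \<open>bN N \<phi>\<close> is a Cauchy sequence, one chooses one \<open>\<psi> \<in> L1\<close> close to \<open>\<phi>\<close>, applies the
  bound to the single vector \<open>\<phi> - \<psi>\<close>, and finds that \<open>bN N \<phi>\<close> eventually stays within a small
  distance of the convergent sequence \<open>bN N \<psi>\<close>. Hence \<open>bN N \<phi>\<close> converges for every \<open>\<phi>\<close>, by
  completeness of the scalars (\<open>convergent_at_closure_point\<close>).

  The extension is this pointwise limit. Linearity passes to the limit
  (\<open>linear_form_of_tendsto\<close>), and so does the bound, now without any threshold, which makes the
  limit Lipschitz. Uniqueness holds already among continuous functions, because two of them that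
  agree on a dense set are equal.
\<close>

text \<open>
  Three-epsilon argument: \<open>f m x - f n x\<close> splits into \<open>f m (x - y)\<close>, \<open>f m y - f n y\<close> and
  \<open>f n (y - x)\<close>, where \<open>y \<in> S\<close> is fixed before the indices are chosen.
\<close>

lemma convergent_at_closure_point:
  fixes f :: "nat \<Rightarrow> 'a::real_normed_vector \<Rightarrow> 'b::banach"
  assumes diff: "\<And>x y. \<forall>\<^sub>F n in sequentially. f n (x - y) = f n x - f n y"
    and bound: "\<And>x. \<forall>\<^sub>F n in sequentially. norm (f n x) \<le> C * norm x"
    and conv: "\<And>y. y \<in> S \<Longrightarrow> convergent (\<lambda>n. f n y)"
    and x: "x \<in> closure S"
    and C: "C > 0"
  shows "convergent (\<lambda>n. f n x)"
proof -
  have "Cauchy (\<lambda>n. f n x)"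
  proof (rule metric_CauchyI)
    fix e :: real
    assume e: "e > 0"
    have "e / (3 * C) > 0"
      using e C by simp
    then obtain y where y: "y \<in> S" and "dist y x < e / (3 * C)"
      using x unfolding closure_approachable by blast
    then have close: "C * norm (x - y) < e / 3"
      using C by (simp add: dist_norm norm_minus_commute field_simps)
    have "\<forall>\<^sub>F n in sequentially. dist (f n x) (f n y) < e / 3"
      using diff[of x y] bound[of "x - y"]
      by eventually_elim (use close in \<open>simp add: dist_norm\<close>)
    then obtain M1 where M1: "\<And>n. n \<ge> M1 \<Longrightarrow> dist (f n x) (f n y) < e / 3"
      unfolding eventually_sequentially by blast
    have "Cauchy (\<lambda>n. f n y)"
      using conv[OF y] by (rule convergent_Cauchy)
    moreover have "e / 3 > 0"
      using e by simp
    ultimately obtain M2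
      where M2: "\<And>m n. m \<ge> M2 \<Longrightarrow> n \<ge> M2 \<Longrightarrow> dist (f m y) (f n y) < e / 3"
      by (meson metric_CauchyD)
    have "dist (f m x) (f n x) < e" if "m \<ge> max M1 M2" "n \<ge> max M1 M2" for m n
    proof -
      have "dist (f m x) (f n x)
          \<le> dist (f m x) (f m y) + dist (f m y) (f n y) + dist (f n x) (f n y)"
        by metric
      also have "\<dots> < e / 3 + e / 3 + e / 3"
        using that by (intro add_strict_mono M1 M2) auto
      finally show ?thesis by simp
    qed
    then show "\<exists>M. \<forall>m\<ge>M. \<forall>n\<ge>M. dist (f m x) (f n x) < e"
      by blast
  qed
  then show ?thesis
    by (simp add: Cauchy_convergent_iff)
qed

lemma linear_form_iff:
  "linear_form f \<longleftrightarrow>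
    (\<forall>x y. f (x + y) = f x + f y) \<and> (\<forall>c x. f (c *\<^sub>C x) = c * f x)"
proof -
  have "vector_space ((*) :: complex \<Rightarrow> complex \<Rightarrow> complex)"
    by unfold_locales (simp_all add: algebra_simps)
  then show ?thesis
    using complex_vector.vector_space_axioms by (auto simp: Vector_Spaces.linear_iff)
qed

lemma linear_form_of_tendsto:
  assumes lin: "\<forall>\<^sub>F n in F. linear_form (f n)"
    and lim: "\<And>x. ((\<lambda>n. f n x) \<longlongrightarrow> g x) F"
    and F: "F \<noteq> bot"
  shows "linear_form g"
  unfolding linear_form_iff
proof (intro conjI allI)
  fix x y
  have "\<forall>\<^sub>F n in F. f n x + f n y = f n (x + y)"
    using lin by eventually_elim (simp add: linear_form_iff)
  then have "((\<lambda>n. f n (x + y)) \<longlongrightarrow> g x + g y) F"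
    by (rule Lim_transform_eventually[OF tendsto_add[OF lim lim]])
  then show "g (x + y) = g x + g y"
    by (rule tendsto_unique[OF F lim])
next
  fix c x
  have "\<forall>\<^sub>F n in F. c * f n x = f n (c *\<^sub>C x)"
    using lin by eventually_elim (simp add: linear_form_iff)
  then have "((\<lambda>n. f n (c *\<^sub>C x)) \<longlongrightarrow> c * g x) F"
    by (rule Lim_transform_eventually[OF tendsto_mult_left[OF lim]])
  then show "g (c *\<^sub>C x) = c * g x"
    by (rule tendsto_unique[OF F lim])
qed

lemma linear_form_diff:
  assumes "linear_form f"
  shows "f (x - y) = f x - f y"
proof -
  interpret Vector_Spaces.linear scaleC "(*)" f
    by (rule assms)
  show ?thesis by (rule diff)
qed

lemma continuous_on_bounded_linear_form:
  assumes "linear_form f" and bound: "\<And>x. cmod (f x) \<le> C * norm x" and "C \<ge> 0"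
  shows "continuous_on UNIV f"
proof -
  have "C-lipschitz_on UNIV f"
    using bound \<open>C \<ge> 0\<close>
    by (auto intro!: lipschitz_onI simp: dist_norm linear_form_diff[OF assms(1), symmetric])
  then show ?thesis
    by (rule lipschitz_on_continuous_on)
qed

lemma eq_of_continuous_of_eq_on_dense:
  fixes f g :: "'a::topological_space \<Rightarrow> 'b::t2_space"
  assumes "continuous_on UNIV f" "continuous_on UNIV g"
    and "closure S = UNIV" and "\<And>x. x \<in> S \<Longrightarrow> f x = g x"
  shows "f = g"
proof -
  have "closure S \<subseteq> {x. f x = g x}"
    using assms by (intro closure_minimal closed_Collect_eq) auto
  then show ?thesis
    using assms(3) by auto
qed

theorem lemma13:
  fixes bN :: "nat \<Rightarrow> 'a::complex_normed_vector \<Rightarrow> complex"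
    and L1 :: "'a set"
    and b :: "'a \<Rightarrow> complex"
  assumes "\<And>N. N \<ge> 1 \<Longrightarrow> linear_form (bN N)"
    and "\<exists>C>0. \<forall>\<phi>. \<exists>N0\<ge>1. \<forall>N\<ge>N0. cmod (bN N \<phi>) \<le> C * norm \<phi>"
    and "complex_vector.subspace L1"
    and "closure L1 = UNIV"
    and "linear_form_on L1 b"
    and "\<And>\<phi>. \<phi> \<in> L1 \<Longrightarrow> (\<lambda>N. bN N \<phi>) \<longlonglongrightarrow> b \<phi>"
  shows "\<exists>b'. linear_form b' \<and> continuous_extension L1 b b' \<and>
    (\<forall>g. continuous_extension L1 b g \<longrightarrow> g = b') \<and>
    (\<forall>\<phi>. (\<lambda>N. bN N \<phi>) \<longlonglongrightarrow> b' \<phi>)"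
proof -
  obtain C where C: "C > 0"
    and bound: "\<And>\<phi>. \<forall>\<^sub>F N in sequentially. cmod (bN N \<phi>) \<le> C * norm \<phi>"
    using assms(2) unfolding eventually_sequentially by blast
  have lin: "\<forall>\<^sub>F N in sequentially. linear_form (bN N)"
    using assms(1) by (rule eventually_sequentiallyI)
  define b' where "b' \<phi> = lim (\<lambda>N. bN N \<phi>)" for \<phi>
  have lim: "(\<lambda>N. bN N \<phi>) \<longlonglongrightarrow> b' \<phi>" for \<phi>
  proof -
    have "convergent (\<lambda>N. bN N \<phi>)"
    proof (rule convergent_at_closure_point[where S = L1 and C = C])
      show "\<forall>\<^sub>F N in sequentially. bN N (x - y) = bN N x - bN N y" for x y
        using lin by eventually_elim (rule linear_form_diff)
      show "convergent (\<lambda>N. bN N \<psi>)" if "\<psi> \<in> L1" for \<psi>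
        using assms(6)[OF that] by (rule convergentI)
    qed (use bound C assms(4) in auto)
    then show ?thesis
      unfolding b'_def by (simp add: convergent_LIMSEQ_iff)
  qed
  have lin': "linear_form b'"
    using lin lim by (rule linear_form_of_tendsto) simp
  have "cmod (b' \<phi>) \<le> C * norm \<phi>" for \<phi>
    using tendsto_norm[OF lim] bound by (rule tendsto_upperbound) simp
  then have "continuous_on UNIV b'"
    using lin' C by (intro continuous_on_bounded_linear_form[where C = C]) auto
  moreover have "b' \<phi> = b \<phi>" if "\<phi> \<in> L1" for \<phi>
    using lim assms(6)[OF that] by (rule LIMSEQ_unique)
  ultimately have ext: "continuous_extension L1 b b'"
    by (simp add: continuous_extension_def)
  have "g = b'" if "continuous_extension L1 b g" for g
    using that ext assms(4)
    by (intro eq_of_continuous_of_eq_on_dense[of g b' L1]) (auto simp: continuous_extension_def)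
  then show ?thesis
    using lin' ext lim by blast
qed

end
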